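(* Let $n$ be the number of qubits of a quantum device whose coupling map has heavy-hexagon connectivity. Let $\mathcal{F}$ be a front layer of CNOT gates, let $\mathcal{U}$ be a set of upcoming gates whose size is bounded by a constant independent of $n$, let $\alpha$ be a fixed real coefficient, and let the (normalized) $n\times n$ matrices $R$ (SWAP paths reliability) and $D$ (distance) be precomputed. Then, for a candidate SWAP gate $s$, computing the score $$h(s) = \frac{\alpha}{|\mathcal{F}\cup \mathcal{U}|} \sum_{g \in \mathcal{F}\cup \mathcal{U}} R(\pi_{s}(g_{c}),\pi_{s}(g_{t})) + \frac{1-\alpha}{|\mathcal{F}\cup \mathcal{U}|} \sum_{g \in \mathcal{F}\cup \mathcal{U}} \bigl(1-D(\pi_{s}(g_{c}),\pi_{s}(g_{t}))\bigr)$$ takes $O(n^{2})$ time.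
   Context: The coupling map of a quantum device with $n$ physical qubits is the graph whose vertices are the physical qubits and whose edges correspond to permitted CNOT gates. It has heavy-hexagon connectivity if it is a heavy-hexagon lattice: qubits are located on the nodes and on the edges of hexagons of a hexagonal lattice, so each qubit has two or three neighbors. A quantum gate $U_i(\mathcal{Q}_i)$ acts on a set $\mathcal{Q}_i$ of qubits. For a circuit on $k$ qubits ($k\le n$), a layer $\mathcal{L}$ is a set of consecutive gates that can be applied concurrently, such that $\mathcal{Q}_i\cap\mathcal{Q}_j=\emptyset$ for all distinct $U_i,U_j\in\mathcal{L}$ and $\sum_{U_i\in\mathcal{L}}|\mathcal{Q}_i|\le k$. The front layer $\mathcal{F}$ is a layer with $|\mathcal{Q}_i|=2$ for all $U_i\in\mathcal{F}$; here it consists of CNOT gates that are not hardware-compliant under the current mapping $\pi$ of virtual qubits to physical qubits (i.e. whose two qubits are not mapped to adjacent vertices of the coupling map). The set $\mathcal{U}$ consists of a few upcoming CNOT gates from subsequent layers; their number (by default 5) is treated as a constant. A candidate SWAP gate $s$ is a SWAP along an edge of the coupling map involving at least one physical qubit on which a CNOT in the front layer acts. $\pi_s$ denotes the mapping of virtual to physical qubits resulting from $\pi$ after applying $s$. For a CNOT gate $g$, $g_c$ and $g_t$ are its control and target virtual qubits, so $\pi_s(g_c)$ and $\pi_s(g_t)$ are the corresponding physical qubits. The reliability of a SWAP $s$ along an edge between $i$ and $j$ is $r(s)=\mu(i,j)^3$, where $\mu(i,j)$ is the success rate of a CNOT between $i$ and $j$ (given by calibration data); the reliability of a sequence $s_0s_1\dots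 s_k$ of SWAPs is $\prod_{i=0}^k r(s_i)$. The matrix $R\in\mathbb{R}^{n\times n}$ stores in entry $(i,j)$ the maximum reliability with which qubit $i$ can be moved to a neighbor of qubit $j$ through a sequence of SWAP gates. The matrix $D\in\mathbb{N}^{n\times n}$ stores in entry $(i,j)$ the minimum distance in the coupling map between qubit $i$ and a neighbor of qubit $j$. Both matrices are normalized (rescaled to compatible scales) before being used in $h$. They are precomputed and the cost of computing them is not included in the time bound; time is counted in elementary operations, with each matrix-entry lookup, mapping lookup and real arithmetic operation taking $O(1)$ time. *)

theory Defs
  imports
    Complex_Main
    "HOL-Library.Landau_Symbols"
    "HOL-Combinatorics.Transposition"
begin

section \<open>Heavy-hexagon coupling maps\<close>

text \<open>
  The hexagonal lattice in its brick-wall drawing: the nodes are the points of the integer grid,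
  and the hexagons are the bricks with lower left corner \<open>(x, y)\<close>, for \<open>x + y\<close> even,
  occupying two horizontal units and one vertical unit. The six corners are listed in cyclic order.
\<close>

type_synonym node = "int \<times> int"

definition hexagon_cells :: "(int \<times> int) set" where
  "hexagon_cells = {(x, y). even (x + y)}"

definition hexagon :: "int \<times> int \<Rightarrow> node list" where
  "hexagon c = (case c of (x, y) \<Rightarrow>
     [(x, y), (x + 1, y), (x + 2, y), (x + 2, y + 1), (x + 1, y + 1), (x, y + 1)])"

definition hexagon_sides :: "int \<times> int \<Rightarrow> node set set" where
  "hexagon_sides c = {{hexagon c ! i, hexagon c ! ((i + 1) mod 6)} | i. i < 6}"

text \<open>
  In a heavy-hexagon lattice a qubit sits on every node and on every edge of the hexagons;
  a node qubit and an edge qubit are neighbours iff the node is an end of the edge.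
\<close>

datatype site = Node node | Side "node set"

definition heavy_sites :: "(int \<times> int) set \<Rightarrow> site set" where
  "heavy_sites H = Node ` (\<Union>c\<in>H. set (hexagon c)) \<union> Side ` (\<Union>c\<in>H. hexagon_sides c)"

definition site_adjacent :: "site \<Rightarrow> site \<Rightarrow> bool" where
  "site_adjacent a b \<longleftrightarrow>
     (\<exists>v e. v \<in> e \<and> (a = Node v \<and> b = Side e \<or> a = Side e \<and> b = Node v))"

text \<open>
  The physical qubits are \<open>0, \<dots>, n - 1\<close>, and \<open>E\<close> is the symmetric set of the ordered pairs of
  adjacent qubits. The lattice is made of a finite set \<open>H\<close> of hexagons. It is required to be
  connected, since otherwise not all distances would be natural numbers.
\<close>

definition heavy_hexagon_coupling :: "nat \<Rightarrow> (nat \<times> nat) set \<Rightarrow> bool" where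
  "heavy_hexagon_coupling n E \<longleftrightarrow>
     (\<exists>H f. finite H \<and> H \<noteq> {} \<and> H \<subseteq> hexagon_cells \<and>
        bij_betw f {..<n} (heavy_sites H) \<and>
        E = {(i, j). i < n \<and> j < n \<and> site_adjacent (f i) (f j)}) \<and>
     (\<forall>i<n. \<forall>j<n. (i, j) \<in> E\<^sup>*)"


section \<open>Reliability and distance matrices\<close>

definition cnot_success_rates :: "(nat \<times> nat) set \<Rightarrow> (nat \<Rightarrow> nat \<Rightarrow> real) \<Rightarrow> bool" where
  "cnot_success_rates E \<mu> \<longleftrightarrow>
     (\<forall>(i, j)\<in>E. 0 \<le> \<mu> i j \<and> \<mu> i j \<le> 1 \<and> \<mu> i j = \<mu> j i)"

definition swaps_reliability :: "(nat \<Rightarrow> nat \<Rightarrow> real) \<Rightarrow> (nat \<times> nat) list \<Rightarrow> real" where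
  "swaps_reliability \<mu> ss = (\<Prod>(i, j)\<leftarrow>ss. \<mu> i j ^ 3)"

definition position_after :: "(nat \<times> nat) list \<Rightarrow> nat \<Rightarrow> nat" where
  "position_after ss i = fold (\<lambda>(a, b). transpose a b) ss i"

text \<open>
  The supremum is a maximum: as the success rates are at most \<open>1\<close>, it suffices to consider the
  finitely many sequences that move the qubit along a simple path. The empty sequence, of
  reliability \<open>1\<close>, is admitted if \<open>i\<close> already is a neighbour of \<open>j\<close>.
\<close>

definition reliability_matrix ::
    "(nat \<times> nat) set \<Rightarrow> (nat \<Rightarrow> nat \<Rightarrow> real) \<Rightarrow> nat \<Rightarrow> nat \<Rightarrow> real" where
  "reliability_matrix E \<mu> i j =
     Sup {swaps_reliability \<mu> ss | ss. set ss \<subseteq> E \<and> (position_after ss i, j) \<in> E}"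

definition distance_matrix :: "(nat \<times> nat) set \<Rightarrow> nat \<Rightarrow> nat \<Rightarrow> nat" where
  "distance_matrix E i j = (LEAST d. \<exists>v. (v, j) \<in> E \<and> (i, v) \<in> E ^^ d)"

text \<open>
  The scale to which the matrices are normalized is left open: any increasing affine rescaling
  is allowed, which covers division by the maximum, min-max scaling and standardization.
\<close>

definition normalization_of ::
    "nat \<Rightarrow> (nat \<Rightarrow> nat \<Rightarrow> real) \<Rightarrow> (nat \<Rightarrow> nat \<Rightarrow> real) \<Rightarrow> bool" where
  "normalization_of n A A' \<longleftrightarrow> (\<exists>a b. a > 0 \<and> (\<forall>i<n. \<forall>j<n. A' i j = a * A i j + b))"


section \<open>Circuits, layers and the score\<close>

text \<open>
  The label tells apart several occurrences in a circuit of the same operation on the same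
  qubits, so that sets of gates are sets of occurrences.
\<close>

datatype gate =
    is_CNOT: CNOT (label: nat) (control: nat) (target: nat)
  | Other (label: nat) (support: "nat set")

fun qubits :: "gate \<Rightarrow> nat set" where
  "qubits (CNOT l c t) = {c, t}"
| "qubits (Other l Q) = Q"

definition layer :: "nat \<Rightarrow> gate set \<Rightarrow> bool" where
  "layer k L \<longleftrightarrow> finite L \<and> (\<forall>g\<in>L. qubits g \<subseteq> {..<k}) \<and>
     (\<forall>g\<in>L. \<forall>g'\<in>L. g \<noteq> g' \<longrightarrow> qubits g \<inter> qubits g' = {}) \<and>
     (\<Sum>g\<in>L. card (qubits g)) \<le> k"

text \<open>
  A circuit on the virtual qubits \<open>0, \<dots>, k - 1\<close> is the list of its layers in the order of
  execution. Every gate occurrence belongs to one layer only.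
\<close>

definition circuit :: "nat \<Rightarrow> gate set list \<Rightarrow> bool" where
  "circuit k Ls \<longleftrightarrow> (\<forall>L\<in>set Ls. layer k L) \<and> sorted_wrt (\<lambda>L M. L \<inter> M = {}) Ls \<and>
     (\<forall>g\<in>\<Union>(set Ls). is_CNOT g \<longrightarrow> control g \<noteq> target g)"

definition qubit_mapping :: "nat \<Rightarrow> nat \<Rightarrow> (nat \<Rightarrow> nat) \<Rightarrow> bool" where
  "qubit_mapping k n \<pi> \<longleftrightarrow> inj_on \<pi> {..<k} \<and> \<pi> ` {..<k} \<subseteq> {..<n}"

definition front_layer ::
    "nat \<Rightarrow> (nat \<times> nat) set \<Rightarrow> (nat \<Rightarrow> nat) \<Rightarrow> gate set \<Rightarrow> bool" where
  "front_layer k E \<pi> F \<longleftrightarrow> layer k F \<and>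
     (\<forall>g\<in>F. is_CNOT g \<and> card (qubits g) = 2 \<and> (\<pi> (control g), \<pi> (target g)) \<notin> E)"

definition upcoming_gates :: "gate set list \<Rightarrow> gate set \<Rightarrow> bool" where
  "upcoming_gates Ls U \<longleftrightarrow> U \<subseteq> \<Union>(set Ls) \<and> (\<forall>g\<in>U. is_CNOT g)"

definition candidate_swap ::
    "(nat \<times> nat) set \<Rightarrow> (nat \<Rightarrow> nat) \<Rightarrow> gate set \<Rightarrow> nat \<times> nat \<Rightarrow> bool" where
  "candidate_swap E \<pi> F s \<longleftrightarrow>
     s \<in> E \<and> (\<exists>g\<in>F. \<exists>v\<in>qubits g. \<pi> v = fst s \<or> \<pi> v = snd s)"

definition mapping_after :: "(nat \<Rightarrow> nat) \<Rightarrow> nat \<times> nat \<Rightarrow> nat \<Rightarrow> nat" where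
  "mapping_after \<pi> s = transpose (fst s) (snd s) \<circ> \<pi>"

definition score ::
    "real \<Rightarrow> (nat \<Rightarrow> nat \<Rightarrow> real) \<Rightarrow> (nat \<Rightarrow> nat \<Rightarrow> real) \<Rightarrow> (nat \<Rightarrow> nat) \<Rightarrow>
     gate set \<Rightarrow> gate set \<Rightarrow> nat \<times> nat \<Rightarrow> real" where
  "score \<alpha> R D \<pi> F U s =
     (let \<pi>\<^sub>s = mapping_after \<pi> s in
        \<alpha> / real (card (F \<union> U)) * (\<Sum>g\<in>F \<union> U. R (\<pi>\<^sub>s (control g)) (\<pi>\<^sub>s (target g)))
      + (1 - \<alpha>) / real (card (F \<union> U)) * (\<Sum>g\<in>F \<union> U. 1 - D (\<pi>\<^sub>s (control g)) (\<pi>\<^sub>s (target g))))"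


section \<open>Real RAM programs and their running time\<close>

text \<open>
  Programs work on registers holding natural or real numbers, and read the arrays and matrices of
  a read-only memory. Every register access, constant, lookup, arithmetic operation, comparison,
  assignment and branching costs one unit of time. Natural numbers can only be used as indices
  and loop counters; there is no conversion between the two sorts of numbers.
\<close>

type_synonym vname = string

datatype nexp =
    NConst nat
  | NVar vname
  | NAdd nexp nexp
  | NSub nexp nexp
  | NLookup vname nexp

datatype rexp =
    RConst int
  | RVar vname
  | RAdd rexp rexp
  | RSub rexp rexp
  | RMul rexp rexp
  | RDiv rexp rexp
  | RLookup vname nexp nexp

datatype bexp =
    Less nexp nexp
  | Equal nexp nexp
  | Neg bexp
  | Conj bexp bexp

datatype com =
    NAssign vname nexp
  | RAssign vname rexp
  | Seq com com
  | Cond bexp com com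
  | While bexp com

record memory =
  arrays :: "vname \<Rightarrow> nat list"
  matrices :: "vname \<Rightarrow> nat \<Rightarrow> nat \<Rightarrow> real"

record state =
  nregs :: "vname \<Rightarrow> nat"
  rregs :: "vname \<Rightarrow> real"

fun nval :: "memory \<Rightarrow> state \<Rightarrow> nexp \<Rightarrow> nat" where
  "nval M \<sigma> (NConst m) = m"
| "nval M \<sigma> (NVar x) = nregs \<sigma> x"
| "nval M \<sigma> (NAdd a b) = nval M \<sigma> a + nval M \<sigma> b"
| "nval M \<sigma> (NSub a b) = nval M \<sigma> a - nval M \<sigma> b"
| "nval M \<sigma> (NLookup A a) =
     (let i = nval M \<sigma> a in if i < length (arrays M A) then arrays M A ! i else 0)"

fun rval :: "memory \<Rightarrow> state \<Rightarrow> rexp \<Rightarrow> real" where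
  "rval M \<sigma> (RConst m) = of_int m"
| "rval M \<sigma> (RVar x) = rregs \<sigma> x"
| "rval M \<sigma> (RAdd a b) = rval M \<sigma> a + rval M \<sigma> b"
| "rval M \<sigma> (RSub a b) = rval M \<sigma> a - rval M \<sigma> b"
| "rval M \<sigma> (RMul a b) = rval M \<sigma> a * rval M \<sigma> b"
| "rval M \<sigma> (RDiv a b) = rval M \<sigma> a / rval M \<sigma> b"
| "rval M \<sigma> (RLookup A a b) = matrices M A (nval M \<sigma> a) (nval M \<sigma> b)"

fun bval :: "memory \<Rightarrow> state \<Rightarrow> bexp \<Rightarrow> bool" where
  "bval M \<sigma> (Less a b) = (nval M \<sigma> a < nval M \<sigma> b)"
| "bval M \<sigma> (Equal a b) = (nval M \<sigma> a = nval M \<sigma> b)"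
| "bval M \<sigma> (Neg b) = (\<not> bval M \<sigma> b)"
| "bval M \<sigma> (Conj b c) = (bval M \<sigma> b \<and> bval M \<sigma> c)"

fun ncost :: "nexp \<Rightarrow> nat" where
  "ncost (NConst m) = 1"
| "ncost (NVar x) = 1"
| "ncost (NAdd a b) = 1 + ncost a + ncost b"
| "ncost (NSub a b) = 1 + ncost a + ncost b"
| "ncost (NLookup A a) = 1 + ncost a"

fun rcost :: "rexp \<Rightarrow> nat" where
  "rcost (RConst m) = 1"
| "rcost (RVar x) = 1"
| "rcost (RAdd a b) = 1 + rcost a + rcost b"
| "rcost (RSub a b) = 1 + rcost a + rcost b"
| "rcost (RMul a b) = 1 + rcost a + rcost b"
| "rcost (RDiv a b) = 1 + rcost a + rcost b"
| "rcost (RLookup A a b) = 1 + ncost a + ncost b"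

fun bcost :: "bexp \<Rightarrow> nat" where
  "bcost (Less a b) = 1 + ncost a + ncost b"
| "bcost (Equal a b) = 1 + ncost a + ncost b"
| "bcost (Neg b) = 1 + bcost b"
| "bcost (Conj b c) = 1 + bcost b + bcost c"

text \<open>\<open>exec M c \<sigma> t \<sigma>'\<close>: started in \<open>\<sigma>\<close>, \<open>c\<close> terminates in \<open>\<sigma>'\<close> after \<open>t\<close> units of time.\<close>

inductive exec :: "memory \<Rightarrow> com \<Rightarrow> state \<Rightarrow> nat \<Rightarrow> state \<Rightarrow> bool" for M where
  exec_NAssign:
    "exec M (NAssign x a) \<sigma> (1 + ncost a) (\<sigma>\<lparr>nregs := (nregs \<sigma>)(x := nval M \<sigma> a)\<rparr>)"
| exec_RAssign:
    "exec M (RAssign x a) \<sigma> (1 + rcost a) (\<sigma>\<lparr>rregs := (rregs \<sigma>)(x := rval M \<sigma> a)\<rparr>)"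
| exec_Seq:
    "exec M c1 \<sigma>1 t1 \<sigma>2 \<Longrightarrow> exec M c2 \<sigma>2 t2 \<sigma>3 \<Longrightarrow> exec M (Seq c1 c2) \<sigma>1 (t1 + t2) \<sigma>3"
| exec_CondTrue:
    "bval M \<sigma> b \<Longrightarrow> exec M c1 \<sigma> t \<sigma>' \<Longrightarrow> exec M (Cond b c1 c2) \<sigma> (1 + bcost b + t) \<sigma>'"
| exec_CondFalse:
    "\<not> bval M \<sigma> b \<Longrightarrow> exec M c2 \<sigma> t \<sigma>' \<Longrightarrow> exec M (Cond b c1 c2) \<sigma> (1 + bcost b + t) \<sigma>'"
| exec_WhileFalse:
    "\<not> bval M \<sigma> b \<Longrightarrow> exec M (While b c) \<sigma> (1 + bcost b) \<sigma>"
| exec_WhileTrue: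
    "bval M \<sigma>1 b \<Longrightarrow> exec M c \<sigma>1 t1 \<sigma>2 \<Longrightarrow> exec M (While b c) \<sigma>2 t2 \<sigma>3 \<Longrightarrow>
     exec M (While b c) \<sigma>1 (1 + bcost b + t1 + t2) \<sigma>3"

text \<open>
  The input consists of the two precomputed matrices, the current mapping (not the one after the
  SWAP), arrays with the control and target qubits of the front layer and of the upcoming gates
  (in the order of arbitrary enumerations \<open>Fs\<close>, \<open>Us\<close>), the dimensions, \<open>\<alpha>\<close>, and the two ends
  of the SWAP. All that is not part of the input is blank.
\<close>

definition input_memory ::
    "nat \<Rightarrow> nat \<Rightarrow> (nat \<Rightarrow> nat \<Rightarrow> real) \<Rightarrow> (nat \<Rightarrow> nat \<Rightarrow> real) \<Rightarrow> (nat \<Rightarrow> nat) \<Rightarrow>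
     gate list \<Rightarrow> gate list \<Rightarrow> memory" where
  "input_memory n k R D \<pi> Fs Us =
     \<lparr>arrays = (\<lambda>_. [])
        (''pi'' := map \<pi> [0..<k],
         ''F_control'' := map control Fs, ''F_target'' := map target Fs,
         ''U_control'' := map control Us, ''U_target'' := map target Us),
      matrices = (\<lambda>_ _ _. 0)
        (''R'' := (\<lambda>i j. if i < n \<and> j < n then R i j else 0),
         ''D'' := (\<lambda>i j. if i < n \<and> j < n then D i j else 0))\<rparr>"

definition input_state ::
    "nat \<Rightarrow> nat \<Rightarrow> real \<Rightarrow> gate list \<Rightarrow> gate list \<Rightarrow> nat \<times> nat \<Rightarrow> state" where
  "input_state n k \<alpha> Fs Us s =
     \<lparr>nregs = (\<lambda>_. 0)
        (''n'' := n, ''k'' := k, ''F_size'' := length Fs, ''U_size'' := length Us,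
         ''swap_fst'' := fst s, ''swap_snd'' := snd s),
      rregs = (\<lambda>_. 0)(''alpha'' := \<alpha>)\<rparr>"

definition outputs_within :: "com \<Rightarrow> memory \<Rightarrow> state \<Rightarrow> real \<Rightarrow> real \<Rightarrow> bool" where
  "outputs_within P M \<sigma> y T \<longleftrightarrow>
     (\<exists>t \<sigma>'. exec M P \<sigma> t \<sigma>' \<and> rregs \<sigma>' ''result'' = y \<and> real t \<le> T)"

end

theory Submission
  imports Defs
begin

text \<open>
  The gates of a layer act on disjoint sets of qubits, so a front layer of CNOTs has at most
  \<open>n / 2\<close> gates. As \<open>F\<close> and \<open>U\<close> are disjoint, two loops that add up the matrix entries of
  their gates compute the score. Each gate costs constant time, because the SWAP is applied to
  the two looked up positions only, and the whole computation takes linear time.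
\<close>

section \<open>Reasoning about executions\<close>

text \<open>Total correctness in weakest-precondition form; the postcondition also sees the elapsed
  time, so the rules below chain backwards through a program.\<close>

definition runs :: "memory \<Rightarrow> com \<Rightarrow> state \<Rightarrow> (nat \<Rightarrow> state \<Rightarrow> bool) \<Rightarrow> bool" where
  "runs M c \<sigma> Q \<longleftrightarrow> (\<exists>t \<sigma>'. exec M c \<sigma> t \<sigma>' \<and> Q t \<sigma>')"

lemma runs_mono:
  assumes "runs M c \<sigma> Q" and "\<And>t \<sigma>'. Q t \<sigma>' \<Longrightarrow> Q' t \<sigma>'"
  shows "runs M c \<sigma> Q'"
  using assms unfolding runs_def by blast

lemma runs_NAssign:
  assumes "Q (1 + ncost a) (\<sigma>\<lparr>nregs := (nregs \<sigma>)(x := nval M \<sigma> a)\<rparr>)"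
  shows "runs M (NAssign x a) \<sigma> Q"
  using assms exec_NAssign unfolding runs_def by blast

lemma runs_RAssign:
  assumes "Q (1 + rcost a) (\<sigma>\<lparr>rregs := (rregs \<sigma>)(x := rval M \<sigma> a)\<rparr>)"
  shows "runs M (RAssign x a) \<sigma> Q"
  using assms exec_RAssign unfolding runs_def by blast

lemma runs_Seq:
  assumes "runs M c1 \<sigma> (\<lambda>t1 \<sigma>1. runs M c2 \<sigma>1 (\<lambda>t2. Q (t1 + t2)))"
  shows "runs M (Seq c1 c2) \<sigma> Q"
  using assms exec_Seq unfolding runs_def by blast

lemma runs_Cond:
  assumes "bval M \<sigma> b \<Longrightarrow> runs M c1 \<sigma> (\<lambda>t. Q (1 + bcost b + t))"
    and "\<not> bval M \<sigma> b \<Longrightarrow> runs M c2 \<sigma> (\<lambda>t. Q (1 + bcost b + t))"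
  shows "runs M (Cond b c1 c2) \<sigma> Q"
  using assms exec_CondTrue exec_CondFalse unfolding runs_def by blast

text \<open>Rule for counting loops: \<open>I j\<close> describes the state after \<open>j\<close>
  rounds. Besides the \<open>m\<close> rounds, the failing test at the end is paid for.\<close>

lemma runs_While:
  assumes init: "I 0 \<sigma>"
    and step: "\<And>j \<sigma>. j < m \<Longrightarrow> I j \<sigma> \<Longrightarrow>
      bval M \<sigma> b \<and> runs M c \<sigma> (\<lambda>t \<sigma>'. t \<le> B \<and> I (Suc j) \<sigma>')"
    and exit: "\<And>\<sigma>. I m \<sigma> \<Longrightarrow> \<not> bval M \<sigma> b"
  shows "runs M (While b c) \<sigma> (\<lambda>t \<sigma>'. t \<le> (1 + bcost b + B) * m + (1 + bcost b) \<and> I m \<sigma>')"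
proof -
  \<comment> \<open>Induction on the number \<open>l\<close> of rounds still to come, as
    \<open>exec_WhileTrue\<close> peels off the first one.\<close>
  have "runs M (While b c) \<sigma> (\<lambda>t \<sigma>'. t \<le> (1 + bcost b + B) * l + (1 + bcost b) \<and> I m \<sigma>')"
    if "l \<le> m" "I (m - l) \<sigma>" for l \<sigma>
    using that
  proof (induction l arbitrary: \<sigma>)
    case 0
    then show ?case
      using exec_WhileFalse[of M \<sigma> b c] exit unfolding runs_def by fastforce
  next
    case (Suc l)
    have "bval M \<sigma> b" and "runs M c \<sigma> (\<lambda>t \<sigma>'. t \<le> B \<and> I (m - l) \<sigma>')"
      using step[of "m - Suc l" \<sigma>] Suc.prems by (simp_all add: Suc_diff_Suc)
    then obtain t1 \<sigma>1 where 1: "exec M c \<sigma> t1 \<sigma>1" "t1 \<le> B" "I (m - l) \<sigma>1"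
      unfolding runs_def by blast
    then obtain t2 \<sigma>2 where 2: "exec M (While b c) \<sigma>1 t2 \<sigma>2"
        "t2 \<le> (1 + bcost b + B) * l + (1 + bcost b)" "I m \<sigma>2"
      using Suc.IH[of \<sigma>1] Suc.prems unfolding runs_def by auto
    have "exec M (While b c) \<sigma> (1 + bcost b + t1 + t2) \<sigma>2"
      using exec_WhileTrue \<open>bval M \<sigma> b\<close> 1(1) 2(1) .
    moreover have "1 + bcost b + t1 + t2 \<le> (1 + bcost b + B) * Suc l + (1 + bcost b)"
      using 1(2) 2(2) by simp
    ultimately show ?case
      using 2(3) unfolding runs_def by blast
  qed
  from this[of m \<sigma>] init show ?thesis by simp
qed


section \<open>The program\<close>

text \<open>A transposition. The tests are nested so that a position just moved is not tested again
  and moved back; the self-assignment serves as a no-op.\<close>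

definition relocate :: "vname \<Rightarrow> com" where
  "relocate x =
     Cond (Equal (NVar x) (NVar ''swap_fst'')) (NAssign x (NVar ''swap_snd''))
       (Cond (Equal (NVar x) (NVar ''swap_snd'')) (NAssign x (NVar ''swap_fst''))
         (NAssign x (NVar x)))"

definition position :: "vname \<Rightarrow> vname \<Rightarrow> com" where
  "position x A = Seq (NAssign x (NLookup ''pi'' (NLookup A (NVar ''i'')))) (relocate x)"

text \<open>\<open>m\<close> counts gates in a real register, since the divisor must be real and
  natural numbers cannot be converted.\<close>

definition accumulate :: com where
  "accumulate =
     Seq (RAssign ''r'' (RAdd (RVar ''r'') (RLookup ''R'' (NVar ''x'') (NVar ''y''))))
    (Seq (RAssign ''d'' (RAdd (RVar ''d'')
            (RSub (RConst 1) (RLookup ''D'' (NVar ''x'') (NVar ''y'')))))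
    (Seq (RAssign ''m'' (RAdd (RVar ''m'') (RConst 1)))
         (NAssign ''i'' (NAdd (NVar ''i'') (NConst 1)))))"

text \<open>Only \<open>i\<close> is reset; \<open>r\<close>, \<open>d\<close> and \<open>m\<close>
  carry over, so a second pass adds to the totals of the first.\<close>

definition sweep :: "vname \<Rightarrow> vname \<Rightarrow> vname \<Rightarrow> com" where
  "sweep A B z =
     Seq (NAssign ''i'' (NConst 0))
         (While (Less (NVar ''i'') (NVar z))
           (Seq (position ''x'' A) (Seq (position ''y'' B) accumulate)))"

definition score_program :: com where
  "score_program =
     Seq (sweep ''F_control'' ''F_target'' ''F_size'')
    (Seq (sweep ''U_control'' ''U_target'' ''U_size'')
         (RAssign ''result''
           (RAdd (RMul (RDiv (RVar ''alpha'') (RVar ''m'')) (RVar ''r''))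
                 (RMul (RDiv (RSub (RConst 1) (RVar ''alpha'')) (RVar ''m'')) (RVar ''d'')))))"

section \<open>Correctness and cost of the pieces of the program\<close>

lemma runs_relocate:
  assumes "x \<noteq> ''swap_fst''" "x \<noteq> ''swap_snd''"
    and "\<And>t. t \<le> 10 \<Longrightarrow> Q t (\<sigma>\<lparr>nregs := (nregs \<sigma>)
      (x := transpose (nregs \<sigma> ''swap_fst'') (nregs \<sigma> ''swap_snd'') (nregs \<sigma> x))\<rparr>)"
  shows "runs M (relocate x) \<sigma> Q"
  \<comment> \<open>A test with its branching costs 4 and an assignment 2, so the run takes 6 or 10
    units.\<close>
  unfolding relocate_def
  by (intro runs_Cond runs_NAssign; insert assms(3); simp add: transpose_def split: if_splits)

lemma runs_position:
  assumes "x \<noteq> ''swap_fst''" "x \<noteq> ''swap_snd''"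
    and "arrays M A = map f gs" "arrays M ''pi'' = map \<pi> [0..<k]"
    and "nregs \<sigma> ''i'' < length gs" "f (gs ! nregs \<sigma> ''i'') < k"
    and "\<And>t. t \<le> 14 \<Longrightarrow> Q t (\<sigma>\<lparr>nregs := (nregs \<sigma>)
      (x := mapping_after \<pi> (nregs \<sigma> ''swap_fst'', nregs \<sigma> ''swap_snd'')
              (f (gs ! nregs \<sigma> ''i'')))\<rparr>)"
  shows "runs M (position x A) \<sigma> Q"
  unfolding position_def
proof (intro runs_Seq runs_NAssign runs_relocate assms(1,2), goal_cases)
  case (1 t)
  \<comment> \<open>The nested lookups and their assignment cost 4, hence 14 = 4 + 10. Both indices
    are in range, so neither lookup yields the default 0.\<close>
  then show ?case
    using assms(1-6) assms(7)[of "4 + t"] by (simp add: mapping_after_def eval_nat_numeral)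
qed

lemma runs_accumulate:
  assumes "\<And>t. t \<le> 22 \<Longrightarrow> Q t (\<sigma>
      \<lparr>rregs := (rregs \<sigma>)
         (''r'' := rregs \<sigma> ''r'' + matrices M ''R'' (nregs \<sigma> ''x'') (nregs \<sigma> ''y''),
          ''d'' := rregs \<sigma> ''d'' + (1 - matrices M ''D'' (nregs \<sigma> ''x'') (nregs \<sigma> ''y'')),
          ''m'' := rregs \<sigma> ''m'' + 1),
       nregs := (nregs \<sigma>)(''i'' := Suc (nregs \<sigma> ''i''))\<rparr>)"
  shows "runs M accumulate \<sigma> Q"
  \<comment> \<open>The four assignments cost 6 + 8 + 4 + 4 = 22.\<close>
  unfolding accumulate_def
  by (intro runs_Seq runs_RAssign runs_NAssign) (use assms in simp)

text \<open>The starting totals are arbitrary so that the lemma serves both passes. A round costs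
  54: the test 4, two positions 14 each and the accumulation 22. The remaining 6 are the reset of
  \<open>i\<close> and the last test.\<close>

lemma runs_sweep:
  fixes gs :: "gate list"
  assumes arrays: "arrays M A = map control gs" "arrays M B = map target gs"
      "arrays M ''pi'' = map \<pi> [0..<k]"
    and gates: "\<And>g. g \<in> set gs \<Longrightarrow> control g < k \<and> target g < k"
    and size: "nregs \<sigma> z = length gs" "z \<notin> {''i'', ''x'', ''y''}"
    and swap: "s = (nregs \<sigma> ''swap_fst'', nregs \<sigma> ''swap_snd'')"
  defines "entry \<equiv> \<lambda>X g.
      matrices M X (mapping_after \<pi> s (control g)) (mapping_after \<pi> s (target g))"
  shows "runs M (sweep A B z) \<sigma> (\<lambda>t \<sigma>'. t \<le> 54 * length gs + 6 \<and>
    (\<forall>v. v \<notin> {''i'', ''x'', ''y''} \<longrightarrow> nregs \<sigma>' v = nregs \<sigma> v) \<and>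
    rregs \<sigma>' = (rregs \<sigma>)
      (''r'' := rregs \<sigma> ''r'' + (\<Sum>g\<leftarrow>gs. entry ''R'' g),
       ''d'' := rregs \<sigma> ''d'' + (\<Sum>g\<leftarrow>gs. 1 - entry ''D'' g),
       ''m'' := rregs \<sigma> ''m'' + length gs))"
proof -
  \<comment> \<open>Nothing is kept about \<open>x\<close> and \<open>y\<close>, which every round
    overwrites before reading them.\<close>
  define I where "I j \<sigma>' \<longleftrightarrow> nregs \<sigma>' ''i'' = j \<and>
    (\<forall>v. v \<notin> {''i'', ''x'', ''y''} \<longrightarrow> nregs \<sigma>' v = nregs \<sigma> v) \<and>
    rregs \<sigma>' = (rregs \<sigma>)
      (''r'' := rregs \<sigma> ''r'' + (\<Sum>g\<leftarrow>take j gs. entry ''R'' g),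
       ''d'' := rregs \<sigma> ''d'' + (\<Sum>g\<leftarrow>take j gs. 1 - entry ''D'' g),
       ''m'' := rregs \<sigma> ''m'' + j)" for j and \<sigma>' :: state
  let ?body = "Seq (position ''x'' A) (Seq (position ''y'' B) accumulate)"
  let ?guard = "Less (NVar ''i'') (NVar z)"
  have step: "runs M ?body \<tau> (\<lambda>t \<sigma>'. t \<le> 50 \<and> I (Suc j) \<sigma>')"
    if j: "j < length gs" and I: "I j \<tau>" for j \<tau>
  proof -
    have i: "nregs \<tau> ''i'' = j" and less: "control (gs ! j) < k" "target (gs ! j) < k"
      using I j gates[of "gs ! j"] by (simp_all add: I_def)
    have take: "take (Suc j) gs = take j gs @ [gs ! j]"
      using j by (rule take_Suc_conv_app_nth)
    show ?thesis
      by (intro runs_Seq runs_accumulate runs_position[OF _ _ arrays(1,3)]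
            runs_position[OF _ _ arrays(2,3)])
        (use I in \<open>simp_all add: i j less I_def entry_def take swap[symmetric] ac_simps\<close>)
  qed
  let ?\<sigma> = "\<sigma>\<lparr>nregs := (nregs \<sigma>)(''i'' := nval M \<sigma> (NConst 0))\<rparr>"
  have "runs M (While ?guard ?body) ?\<sigma>
    (\<lambda>t \<sigma>'. t \<le> (1 + bcost ?guard + 50) * length gs + (1 + bcost ?guard) \<and> I (length gs) \<sigma>')"
    by (rule runs_While) (use step size in \<open>auto simp: I_def\<close>)
  then have "runs M (While ?guard ?body) ?\<sigma>
      (\<lambda>t \<sigma>'. t + 2 \<le> 54 * length gs + 6 \<and> I (length gs) \<sigma>')"
    by (rule runs_mono) simp
  then show ?thesis
    unfolding sweep_def
    by (intro runs_Seq[OF runs_NAssign], elim runs_mono) (simp add: I_def)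
qed

text \<open>Distinct enumerations of disjoint sets turn the two list sums into one sum over the
  union, and the counter \<open>m\<close> into its cardinality. The 26 is 6 for each sweep plus 14
  for the final assignment.\<close>

lemma runs_score_program:
  assumes gates: "\<And>g. g \<in> set Fs \<union> set Us \<Longrightarrow> control g < k \<and> target g < k"
    and \<pi>: "qubit_mapping k n \<pi>" and s: "fst s < n" "snd s < n"
    and distinct: "distinct Fs" "distinct Us" "set Fs \<inter> set Us = {}"
  shows "runs (input_memory n k R D \<pi> Fs Us) score_program (input_state n k \<alpha> Fs Us s)
    (\<lambda>t \<sigma>. t \<le> 54 * (length Fs + length Us) + 26 \<and>
      rregs \<sigma> ''result'' = score \<alpha> R D \<pi> (set Fs) (set Us) s)"
proof -
  let ?M = "input_memory n k R D \<pi> Fs Us" and ?p = "mapping_after \<pi> s"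
  let ?entry = "\<lambda>X g. matrices ?M X (?p (control g)) (?p (target g))"
  \<comment> \<open>Both ends of the SWAP are below \<open>n\<close>, so every index stays in the
    range where the stored matrices agree with \<open>R\<close> and \<open>D\<close> instead of
    being 0.\<close>
  have p: "?p q < n" if "q < k" for q
    using that \<pi> s by (auto simp: mapping_after_def qubit_mapping_def transpose_def)
  have entry: "?entry ''R'' g = R (?p (control g)) (?p (target g))"
      "?entry ''D'' g = D (?p (control g)) (?p (target g))" if "g \<in> set Fs \<union> set Us" for g
    using gates[OF that] p by (simp_all add: input_memory_def)
  have sum: "(\<Sum>g\<leftarrow>Fs. h g) + (\<Sum>g\<leftarrow>Us. h g) = (\<Sum>g\<in>set Fs \<union> set Us. h g)" for h :: "gate \<Rightarrow> real"
    using distinct by (simp add: sum.union_disjoint sum.distinct_set_conv_list)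
  have card: "card (set Fs \<union> set Us) = length Fs + length Us"
    using distinct by (simp add: card_Un_disjoint distinct_card)
  have r: "(\<Sum>g\<leftarrow>Fs. ?entry ''R'' g) + (\<Sum>g\<leftarrow>Us. ?entry ''R'' g)
      = (\<Sum>g\<in>set Fs \<union> set Us. R (?p (control g)) (?p (target g)))"
    unfolding sum by (intro sum.cong refl entry)
  have d: "(\<Sum>g\<leftarrow>Fs. 1 - ?entry ''D'' g) + (\<Sum>g\<leftarrow>Us. 1 - ?entry ''D'' g)
      = (\<Sum>g\<in>set Fs \<union> set Us. 1 - D (?p (control g)) (?p (target g)))"
    unfolding sum by (intro sum.cong refl) (simp add: entry)
  note sweep = runs_sweep[of ?M _ _ _ \<pi> k _ _ s]
  show ?thesis
    unfolding score_program_def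
  \<comment> \<open>Goals 1 to 7 are the premises of \<open>sweep\<close>; goal 8 is the rest of the
    program, run from the state the sweep leaves.\<close>
  proof (rule runs_Seq, rule runs_mono, rule sweep[of _ Fs], goal_cases)
    case first: (8 t1 \<sigma>1)
    show ?case
    proof (rule runs_Seq, rule runs_mono, rule sweep[of _ Us], goal_cases)
      case second: (8 t2 \<sigma>2)
      have "rregs \<sigma>2 ''alpha'' = \<alpha>" "rregs \<sigma>2 ''m'' = card (set Fs \<union> set Us)"
          "rregs \<sigma>2 ''r'' = (\<Sum>g\<in>set Fs \<union> set Us. R (?p (control g)) (?p (target g)))"
          "rregs \<sigma>2 ''d'' = (\<Sum>g\<in>set Fs \<union> set Us. 1 - D (?p (control g)) (?p (target g)))"
        using first second unfolding r[symmetric] d[symmetric] card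
        by (simp_all add: input_state_def)
      then show ?case
        by (intro runs_RAssign) (use first second in \<open>simp add: score_def Let_def\<close>)
    qed (use first gates in \<open>simp_all add: input_memory_def input_state_def\<close>)
  qed (use gates in \<open>simp_all add: input_memory_def input_state_def\<close>)
qed


section \<open>The running time\<close>

text \<open>Each gate contributes 2 to the total that the definition of \<open>layer\<close> bounds
  by \<open>k\<close>. This ties the size of \<open>F\<close> to that of the device.\<close>

lemma front_layer_card:
  assumes "front_layer k E \<pi> F"
  shows "2 * card F \<le> k"
proof -
  have "2 * card F = (\<Sum>g\<in>F. card (qubits g))"
    using assms by (simp add: front_layer_def)
  also have "\<dots> \<le> k"
    using assms unfolding front_layer_def layer_def by blast
  finally show ?thesis .
qed

lemma layer_CNOT_less:
  assumes "layer k L" "g \<in> L" "is_CNOT g"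
  shows "control g < k \<and> target g < k"
  using assms by (cases g) (auto simp: layer_def)

theorem theorem3p2:
  "\<exists>P :: com. \<forall>(\<alpha> :: real) (b :: nat). \<exists>T :: nat \<Rightarrow> real.
     T \<in> O(\<lambda>n. real n ^ 2) \<and>
     (\<forall>(n :: nat) E \<mu> R D k \<pi> F Ls U s Fs Us.
        heavy_hexagon_coupling n E \<longrightarrow>
        cnot_success_rates E \<mu> \<longrightarrow>
        normalization_of n (reliability_matrix E \<mu>) R \<longrightarrow>
        normalization_of n (\<lambda>i j. real (distance_matrix E i j)) D \<longrightarrow>
        k \<le> n \<longrightarrow>
        qubit_mapping k n \<pi> \<longrightarrow>
        circuit k (F # Ls) \<longrightarrow>
        front_layer k E \<pi> F \<longrightarrow>
        upcoming_gates Ls U \<longrightarrow>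
        card U \<le> b \<longrightarrow>
        candidate_swap E \<pi> F s \<longrightarrow>
        distinct Fs \<longrightarrow> set Fs = F \<longrightarrow>
        distinct Us \<longrightarrow> set Us = U \<longrightarrow>
        outputs_within P (input_memory n k R D \<pi> Fs Us) (input_state n k \<alpha> Fs Us s)
          (score \<alpha> R D \<pi> F U s) (T n))"
proof (intro exI[of _ score_program] allI)
  fix \<alpha> :: real and b :: nat
  \<comment> \<open>The time of \<open>score_program\<close> with \<open>length Fs \<le> n\<close>
    and \<open>length Us \<le> b\<close>; linear in \<open>n\<close>, as \<open>b\<close> is
    fixed.\<close>
  let ?T = "\<lambda>n. real (54 * (n + b) + 26)"
  have time: "?T \<in> O(\<lambda>n. real n ^ 2)"
  proof (intro bigoI[where c = "real (80 + 54 * b)"] eventually_sequentiallyI[of 1])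
    fix n :: nat
    assume "1 \<le> n"
    then have "n \<le> n ^ 2" "b \<le> b * n ^ 2" "1 \<le> n ^ 2"
      by (simp_all add: power2_eq_square)
    \<comment> \<open>With \<open>q\<close> for \<open>n ^ 2\<close> and \<open>c\<close> for
      \<open>b * n ^ 2\<close> the estimate is linear; 80 = 54 + 26 absorbs \<open>54 * n\<close>
      and the constant.\<close>
    moreover have "54 * (n + b) + 26 \<le> 80 * q + 54 * c" if "n \<le> q" "b \<le> c" "1 \<le> q" for q c
      using that by simp
    ultimately have "54 * (n + b) + 26 \<le> (80 + 54 * b) * n ^ 2"
      unfolding add_mult_distrib mult.assoc by blast
    then have "?T n \<le> real ((80 + 54 * b) * n ^ 2)"
      unfolding of_nat_le_iff .
    then show "norm (?T n) \<le> real (80 + 54 * b) * norm (real n ^ 2)"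
      by simp
  qed
  have "outputs_within score_program (input_memory n k R D \<pi> Fs Us)
      (input_state n k \<alpha> Fs Us s) (score \<alpha> R D \<pi> F U s) (?T n)"
    if E: "heavy_hexagon_coupling n E" and "k \<le> n" and \<pi>: "qubit_mapping k n \<pi>"
      and circuit: "circuit k (F # Ls)" and F: "front_layer k E \<pi> F"
      and U: "upcoming_gates Ls U" "card U \<le> b" and s: "candidate_swap E \<pi> F s"
      and Fs: "distinct Fs" "set Fs = F" and Us: "distinct Us" "set Us = U"
    for n E R D k \<pi> F Ls U s Fs Us
  proof -
    \<comment> \<open>\<open>F\<close> heads a list of pairwise disjoint layers and \<open>U\<close>
      is drawn from the later ones, so the two share no gate.\<close>
    have layers: "\<forall>L\<in>set (F # Ls). layer k L" and disjoint: "\<forall>L\<in>set Ls. F \<inter> L = {}"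
      using circuit unfolding circuit_def by simp_all
    have "set Us \<subseteq> \<Union>(set Ls)" and CNOT: "\<forall>g\<in>set Fs \<union> set Us. is_CNOT g"
      using F U(1) Fs(2) Us(2) unfolding front_layer_def upcoming_gates_def by blast+
    then have "set Fs \<union> set Us \<subseteq> \<Union>(set (F # Ls))"
      using Fs(2) by auto
    then have "control g < k \<and> target g < k" if "g \<in> set Fs \<union> set Us" for g
      using that layers CNOT layer_CNOT_less by (meson UnionE subsetD)
    moreover have "fst s < n" "snd s < n"
      using E s unfolding heavy_hexagon_coupling_def candidate_swap_def by auto
    moreover have "set Fs \<inter> set Us = {}"
      using disjoint \<open>set Us \<subseteq> \<Union>(set Ls)\<close> Fs(2) by blast
    ultimately have "runs (input_memory n k R D \<pi> Fs Us) score_program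
        (input_state n k \<alpha> Fs Us s) (\<lambda>t \<sigma>. t \<le> 54 * (length Fs + length Us) + 26 \<and>
          rregs \<sigma> ''result'' = score \<alpha> R D \<pi> F U s)"
      using runs_score_program[OF _ \<pi>] Fs Us by blast
    moreover have "length Fs \<le> n" "length Us \<le> b"
      using front_layer_card[OF F] \<open>k \<le> n\<close> U(2) Fs Us
      by (simp_all add: distinct_card[symmetric])
    ultimately show ?thesis
      unfolding runs_def outputs_within_def of_nat_le_iff by fastforce
  qed
  with time show "\<exists>T. T \<in> O(\<lambda>n. real n ^ 2) \<and> (\<forall>n E \<mu> R D k \<pi> F Ls U s Fs Us.
      heavy_hexagon_coupling n E \<longrightarrow> cnot_success_rates E \<mu> \<longrightarrow>
      normalization_of n (reliability_matrix E \<mu>) R \<longrightarrow>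
      normalization_of n (\<lambda>i j. real (distance_matrix E i j)) D \<longrightarrow> k \<le> n \<longrightarrow>
      qubit_mapping k n \<pi> \<longrightarrow> circuit k (F # Ls) \<longrightarrow> front_layer k E \<pi> F \<longrightarrow>
      upcoming_gates Ls U \<longrightarrow> card U \<le> b \<longrightarrow> candidate_swap E \<pi> F s \<longrightarrow>
      distinct Fs \<longrightarrow> set Fs = F \<longrightarrow> distinct Us \<longrightarrow> set Us = U \<longrightarrow>
      outputs_within score_program (input_memory n k R D \<pi> Fs Us)
        (input_state n k \<alpha> Fs Us s) (score \<alpha> R D \<pi> F U s) (T n))"
    by (intro exI[of _ ?T] conjI allI impI)
qed

end
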